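(* Suppose that $\hat{\mathcal{I}}$ commutes with $d\sigma\big|_{\mathfrak{p}}$. That is, \[ \hat{\mathcal{I}}(-P)(x) = -\hat{\mathcal{I}}P(x) \] for every $x \in \Omega$. Then $\mathcal{I}$ commutes with $s_\eta$. That is, \[ \mathcal{I} (s_\eta(u))(x) = s_\eta(\mathcal{I}u(x)) \] for every $x \in \Omega$.
   Context: Let $G$ be a Lie group with identity $e$ and Lie algebra $\mathfrak{g}$, let $\exp:\mathfrak{g}\to G$ be the Lie group exponential map, and let $\sigma : G \to G$ be an involutive automorphism: $\sigma\neq\mathrm{id}$ is a bijection with $\sigma(\sigma(g))=g$ and $\sigma(gh)=\sigma(g)\sigma(h)$ for all $g,h\in G$. Let $G^\sigma=\{g\in G \mid \sigma(g)=g\}$. Let $d\sigma:\mathfrak{g}\to\mathfrak{g}$ be the differential of $\sigma$ at $e$, and let $\mathfrak{p}=\{Z\in\mathfrak{g}\mid d\sigma(Z)=-Z\}$, so that $d\sigma(P)=-P$ for $P\in\mathfrak{p}$. Let $G$ act transitively on a smooth manifold $\mathcal{S}$, the action being written $g\cdot u$, and let $\eta\in\mathcal{S}$ be a distinguished element whose stabilizer coincides with $G^\sigma$. Define $s_\eta:\mathcal{S}\to\mathcal{S}$ by $s_\eta(g\cdot\eta)=\sigma(g)\cdot\eta$ for each $g\in G$; this is well defined because the stabilizer of $\eta$ is $G^\sigma$. Let $F(P)=\exp(P)\cdot\eta$ for $P\in\mathfrak{p}$. When restricted to suitable neighborhoods, $F$ is a diffeomorphism from a neighborhood of $0\in\mathfrak{p}$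 to a neighborhood of $\eta\in\mathcal{S}$, and $F^{-1}$ denotes its inverse. Let $\Omega\subset\mathbb{R}^d$, $d\ge1$, be a domain, let $x^{(1)},\dots,x^{(m)}\in\Omega$, and let $u_1,\dots,u_m\in\mathcal{S}$ be the values at these points of a smooth function $u:\Omega\to\mathcal{S}$, i.e. $u_i=u(x^{(i)})$. It is assumed that for each $x\in\Omega$, $u(x)$ belongs to the range of $F$. Let $\hat{\mathcal{I}}$ be an interpolation operator for $\mathfrak{p}$-valued functions: for $P$ taking values in $\mathfrak{p}$, $\hat{\mathcal{I}}P:\Omega\to\mathfrak{p}$ is an interpolant of the values $P(x^{(1)}),\dots,P(x^{(m)})$. The interpolant $\mathcal{I}u:\Omega\to\mathcal{S}$ of $u_1,\dots,u_m$ is defined by \[ \mathcal{I}u(x)=F(\hat{\mathcal{I}}P(x)),\qquad P(x)=F^{-1}(u(x)), \] so that $\hat{\mathcal{I}}P$ interpolates $F^{-1}(u_1),\dots,F^{-1}(u_m)$. The interpolant $\mathcal{I}(s_\eta(u))$ is obtained by the same construction applied to the function $x\mapsto s_\eta(u(x))$.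
   Formalization: The neighborhood of 0 in p on which F is inverted is assumed symmetric under P ↦ −P; without this, F^{-1}(s_η(u)) may be undefined or differ from −F^{-1}(u), and the claim can fail. *)

theory Defs
  imports "HOL-Analysis.Analysis" "HOL-Algebra.Group_Action"
begin

section \<open>Smooth maps between finite-dimensional vector spaces\<close>

text \<open>Continuity of all iterated derivatives is expressed one derivative at a time: the Frechet
  derivative is continuous, and its value in each fixed direction is again k times
  continuously differentiable. In finite dimension this is the usual notion. The set is meant to
  be open.\<close>

primrec Ck_on :: "nat \<Rightarrow> 'a::real_normed_vector set \<Rightarrow> ('a \<Rightarrow> 'b::real_normed_vector) \<Rightarrow> bool" where
  "Ck_on 0 A f = continuous_on A f"
| "Ck_on (Suc k) A f =
     (\<exists>f' :: 'a \<Rightarrow> 'a \<Rightarrow>\<^sub>L 'b.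
        (\<forall>x\<in>A. (f has_derivative blinfun_apply (f' x)) (at x)) \<and>
        continuous_on A f' \<and>
        (\<forall>v. Ck_on k A (\<lambda>x. blinfun_apply (f' x) v)))"

definition smooth_on :: "'a::real_normed_vector set \<Rightarrow> ('a \<Rightarrow> 'b::real_normed_vector) \<Rightarrow> bool" where
  "smooth_on A f \<longleftrightarrow> open A \<and> (\<forall>k. Ck_on k A f)"


section \<open>Smooth manifolds\<close>

text \<open>A chart is a domain with a coordinate map. Coordinates take values in a finite-dimensional
  normed space and not in a type of class \<open>euclidean_space\<close>, because that class excludes
  dimension 0 (discrete groups, one-point symmetric spaces). The atlas need not be maximal.\<close>

type_synonym ('m, 'e) chart = "'m set \<times> ('m \<Rightarrow> 'e)"

record ('m, 'e) mfd =
  mtop :: "'m topology"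
  atlas :: "('m, 'e) chart set"

definition smooth_manifold :: "('m, 'e::real_normed_vector) mfd \<Rightarrow> bool" where
  "smooth_manifold M \<longleftrightarrow>
     (\<exists>B :: 'e set. finite B \<and> span B = UNIV) \<and>
     Hausdorff_space (mtop M) \<and> second_countable (mtop M) \<and>
     topspace (mtop M) = (\<Union>(D, \<phi>)\<in>atlas M. D) \<and>
     (\<forall>(D, \<phi>)\<in>atlas M.
        openin (mtop M) D \<and> open (\<phi> ` D) \<and>
        homeomorphic_map (subtopology (mtop M) D) (top_of_set (\<phi> ` D)) \<phi>) \<and>
     (\<forall>(D, \<phi>)\<in>atlas M. \<forall>(D', \<psi>)\<in>atlas M.
        smooth_on (\<phi> ` (D \<inter> D')) (\<psi> \<circ> inv_into D \<phi>))"

definition smooth_map ::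
    "('m, 'e::real_normed_vector) mfd \<Rightarrow> ('n, 'f::real_normed_vector) mfd \<Rightarrow> ('m \<Rightarrow> 'n) \<Rightarrow> bool" where
  "smooth_map M N f \<longleftrightarrow>
     continuous_map (mtop M) (mtop N) f \<and>
     (\<forall>(D, \<phi>)\<in>atlas M. \<forall>(D', \<psi>)\<in>atlas N.
        smooth_on (\<phi> ` {x \<in> D. f x \<in> D'}) (\<psi> \<circ> f \<circ> inv_into D \<phi>))"

definition prod_mfd :: "('m, 'e) mfd \<Rightarrow> ('n, 'f) mfd \<Rightarrow> ('m \<times> 'n, 'e \<times> 'f) mfd" where
  "prod_mfd M N =
     \<lparr>mtop = prod_topology (mtop M) (mtop N),
      atlas = {(D \<times> D', map_prod \<phi> \<psi>) | D \<phi> D' \<psi>. (D, \<phi>) \<in> atlas M \<and> (D', \<psi>) \<in> atlas N}\<rparr>"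

definition open_submfd :: "('m, 'e) mfd \<Rightarrow> 'm set \<Rightarrow> ('m, 'e) mfd" where
  "open_submfd M W =
     \<lparr>mtop = subtopology (mtop M) W, atlas = {(D \<inter> W, \<phi>) | D \<phi>. (D, \<phi>) \<in> atlas M}\<rparr>"

definition vec_mfd :: "'a::real_normed_vector set \<Rightarrow> ('a, 'a) mfd" where
  "vec_mfd W = \<lparr>mtop = top_of_set W, atlas = {(W, \<lambda>x. x)}\<rparr>"

text \<open>A map on an arbitrary subset of a vector space is smooth if it extends locally to a smooth
  map on an open set. For a relatively open subset of a linear subspace this agrees with
  smoothness with respect to the subspace.\<close>

definition smooth_from_subset ::
    "'a::real_normed_vector set \<Rightarrow> ('n, 'f::real_normed_vector) mfd \<Rightarrow> ('a \<Rightarrow> 'n) \<Rightarrow> bool" where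
  "smooth_from_subset X N f \<longleftrightarrow>
     (\<forall>x\<in>X. \<exists>W g. open W \<and> x \<in> W \<and> smooth_map (vec_mfd W) N g \<and> (\<forall>y\<in>X \<inter> W. g y = f y))"

definition diffeo_onto ::
    "'a::real_normed_vector set \<Rightarrow> ('n, 'f::real_normed_vector) mfd \<Rightarrow> 'n set \<Rightarrow> ('a \<Rightarrow> 'n) \<Rightarrow> bool" where
  "diffeo_onto U N V f \<longleftrightarrow>
     bij_betw f U V \<and> smooth_from_subset U N f \<and>
     smooth_map (open_submfd N V) (vec_mfd UNIV) (inv_into U f)"


section \<open>Lie groups\<close>

definition lie_group :: "('g, 'x) monoid_scheme \<Rightarrow> ('g, 'e::real_normed_vector) mfd \<Rightarrow> bool" where
  "lie_group G M \<longleftrightarrow>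
     group G \<and> smooth_manifold M \<and> topspace (mtop M) = carrier G \<and>
     smooth_map (prod_mfd M M) M (\<lambda>(g, h). g \<otimes>\<^bsub>G\<^esub> h) \<and>
     smooth_map M M (\<lambda>g. inv\<^bsub>G\<^esub> g)"

text \<open>The Lie algebra, the tangent space at the identity, is represented in a chart \<open>c\<close> around the
  identity: a tangent vector is its coordinate vector in \<open>c\<close>, so the underlying vector space is the
  whole model space. Another choice of \<open>c\<close> changes this representation by the derivative
  of the transition map.\<close>

definition one_parameter_subgroup ::
    "('g, 'x) monoid_scheme \<Rightarrow> ('g, 'e::real_normed_vector) mfd \<Rightarrow> ('g, 'e) chart \<Rightarrow> 'e \<Rightarrow>
     (real \<Rightarrow> 'g) \<Rightarrow> bool" where
  "one_parameter_subgroup G M c Z \<gamma> \<longleftrightarrow>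
     smooth_map (vec_mfd UNIV) M \<gamma> \<and> (\<forall>s t. \<gamma> (s + t) = \<gamma> s \<otimes>\<^bsub>G\<^esub> \<gamma> t) \<and>
     ((\<lambda>t. snd c (\<gamma> t)) has_vector_derivative Z) (at 0)"

text \<open>In a Lie group each tangent vector has exactly one one-parameter subgroup, so the
  \<open>else\<close> branch only makes the function total.\<close>

definition lie_exp ::
    "('g, 'x) monoid_scheme \<Rightarrow> ('g, 'e::real_normed_vector) mfd \<Rightarrow> ('g, 'e) chart \<Rightarrow> 'e \<Rightarrow> 'g" where
  "lie_exp G M c Z =
     (if \<exists>!\<gamma>. one_parameter_subgroup G M c Z \<gamma>
      then (THE \<gamma>. one_parameter_subgroup G M c Z \<gamma>) 1 else \<one>\<^bsub>G\<^esub>)"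

definition differential_at_one ::
    "('g, 'x) monoid_scheme \<Rightarrow> ('g, 'e::real_normed_vector) chart \<Rightarrow> ('g \<Rightarrow> 'g) \<Rightarrow> 'e \<Rightarrow> 'e" where
  "differential_at_one G c \<sigma> =
     frechet_derivative (snd c \<circ> \<sigma> \<circ> inv_into (fst c) (snd c)) (at (snd c \<one>\<^bsub>G\<^esub>))"


section \<open>Symmetric spaces and interpolation\<close>

definition involutive_automorphism :: "('g, 'x) monoid_scheme \<Rightarrow> ('g \<Rightarrow> 'g) \<Rightarrow> bool" where
  "involutive_automorphism G \<sigma> \<longleftrightarrow>
     \<sigma> \<in> iso G G \<and> (\<forall>g\<in>carrier G. \<sigma> (\<sigma> g) = g) \<and> (\<exists>g\<in>carrier G. \<sigma> g \<noteq> g)"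

definition fixed_subgroup :: "('g, 'x) monoid_scheme \<Rightarrow> ('g \<Rightarrow> 'g) \<Rightarrow> 'g set" where
  "fixed_subgroup G \<sigma> = {g \<in> carrier G. \<sigma> g = g}"

definition minus_eigenspace ::
    "('g, 'x) monoid_scheme \<Rightarrow> ('g, 'e::real_normed_vector) chart \<Rightarrow> ('g \<Rightarrow> 'g) \<Rightarrow> 'e set" where
  "minus_eigenspace G c \<sigma> = {Z. differential_at_one G c \<sigma> Z = - Z}"

definition symmetry_at ::
    "('g, 'x) monoid_scheme \<Rightarrow> ('g \<Rightarrow> 's \<Rightarrow> 's) \<Rightarrow> ('g \<Rightarrow> 'g) \<Rightarrow> 's \<Rightarrow> 's \<Rightarrow> 's" where
  "symmetry_at G act \<sigma> \<eta> u = (THE v. \<exists>g\<in>carrier G. u = act g \<eta> \<and> v = act (\<sigma> g) \<eta>)"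

definition exp_orbit_map ::
    "('g, 'x) monoid_scheme \<Rightarrow> ('g, 'e::real_normed_vector) mfd \<Rightarrow> ('g, 'e) chart \<Rightarrow>
     ('g \<Rightarrow> 's \<Rightarrow> 's) \<Rightarrow> 's \<Rightarrow> 'e \<Rightarrow> 's" where
  "exp_orbit_map G M c act \<eta> P = act (lie_exp G M c P) \<eta>"

text \<open>Functions on \<open>\<Omega>\<close> with values in \<open>\<pp>\<close> are modelled as extensional functions, so
  that an operator cannot depend on values outside \<open>\<Omega>\<close>.\<close>

definition interpolation_operator ::
    "'d set \<Rightarrow> 'e set \<Rightarrow> nat \<Rightarrow> (nat \<Rightarrow> 'd) \<Rightarrow> (('d \<Rightarrow> 'e) \<Rightarrow> 'd \<Rightarrow> 'e) \<Rightarrow> bool" where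
  "interpolation_operator \<Omega> \<pp> m pt Ihat \<longleftrightarrow>
     (\<forall>P \<in> \<Omega> \<rightarrow>\<^sub>E \<pp>. Ihat P \<in> \<Omega> \<rightarrow>\<^sub>E \<pp> \<and> (\<forall>i\<in>{1..m}. Ihat P (pt i) = P (pt i)))"

definition interpolant ::
    "('e \<Rightarrow> 's) \<Rightarrow> 'e set \<Rightarrow> (('d \<Rightarrow> 'e) \<Rightarrow> 'd \<Rightarrow> 'e) \<Rightarrow> 'd set \<Rightarrow> ('d \<Rightarrow> 's) \<Rightarrow> 'd \<Rightarrow> 's" where
  "interpolant F U Ihat \<Omega> u x = F (Ihat (\<lambda>y\<in>\<Omega>. inv_into U F (u y)) x)"

end

theory Submission
  imports Defs
begin

text \<open>For a one-parameter subgroup \<open>\<gamma>\<close> with velocity \<open>P \<in> \<pp>\<close>, the composition \<open>\<sigma> \<circ> \<gamma>\<close> is the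
  one-parameter subgroup with velocity \<open>- P\<close>, whence \<open>exp (- P) = \<sigma> (exp P)\<close> and
  \<open>F (- P) = s\<^sub>\<eta> (F P)\<close> on all of \<open>\<pp>\<close>. As \<open>U\<close> is symmetric and \<open>F\<close> is injective there, passing from \<open>u\<close>
  to \<open>s\<^sub>\<eta> \<circ> u\<close> replaces the interpolated function \<open>P\<close> by \<open>- P\<close>.

  Most of the work is the smoothness of \<open>\<sigma> \<circ> \<gamma>\<close>. Since \<open>Ck_on\<close> only controls directional
  derivatives, its chain rule expands \<open>f' x v\<close> in a basis, which requires the coordinate
  functionals of a finite-dimensional normed space to be bounded.\<close>

section \<open>Coordinates in finite-dimensional normed spaces\<close>

text \<open>By compactness, the norm of \<open>\<Sum>b\<in>B. a b *\<^sub>R b\<close> has a positive minimum over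
  the coefficients of \<open>l\<^sup>1\<close>-norm 1.\<close>

lemma coordinate_bound:
  fixes B :: "'a::real_normed_vector set"
  assumes "finite B" "independent B"
  shows "\<exists>C. \<forall>a. (\<Sum>b\<in>B. \<bar>a b\<bar>) \<le> C * norm (\<Sum>b\<in>B. a b *\<^sub>R b)"
proof (cases "B = {}")
  case True
  then show ?thesis by auto
next
  case False
  \<comment> \<open>The \<open>l\<^sup>1\<close> unit sphere of coefficients, extended by 0 off
    \<open>B\<close>: as a subset of a product of compact intervals over the whole type, it is
    compact by Tychonoff.\<close>
  define K where "K = (\<Pi>\<^sub>E b\<in>UNIV. if b \<in> B then {-1..1} else {0::real}) \<inter> {a. (\<Sum>b\<in>B. \<bar>a b\<bar>) = 1}"
  have "compactin (product_topology (\<lambda>_::'a. euclidean :: real topology) UNIV) (\<Pi>\<^sub>E b\<in>UNIV. if b \<in> B then {-1..1} else {0::real})"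
    by (subst compactin_PiE) auto
  then have "compact (\<Pi>\<^sub>E b\<in>UNIV. if b \<in> B then {-1..1} else {0::real})"
    by (simp add: euclidean_product_topology)
  moreover have "closed {a :: 'a \<Rightarrow> real. (\<Sum>b\<in>B. \<bar>a b\<bar>) = 1}"
    by (intro closed_Collect_eq continuous_intros) auto
  ultimately have K: "compact K"
    unfolding K_def by (rule compact_Int_closed)
  have unit: "\<exists>a\<in>K. \<forall>b\<in>B. a b = a' b" if "(\<Sum>b\<in>B. \<bar>a' b\<bar>) = 1" for a'
  proof
    have "\<bar>a' b\<bar> \<le> 1" if "b \<in> B" for b
      using member_le_sum[of b B "\<lambda>b. \<bar>a' b\<bar>"] \<open>(\<Sum>b\<in>B. \<bar>a' b\<bar>) = 1\<close> that assms(1) by simp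
    then show "(\<lambda>b. if b \<in> B then a' b else 0) \<in> K"
      using that by (fastforce simp: K_def abs_le_iff)
  qed auto
  obtain b0 where "b0 \<in> B" using False by blast
  then have "K \<noteq> {}"
    using unit[of "\<lambda>b. if b = b0 then 1 else 0"] assms(1) by (force simp: if_distrib[of abs] sum.delta cong: if_cong)
  have "continuous_on K (\<lambda>a. norm (\<Sum>b\<in>B. a b *\<^sub>R b))"
    by (intro continuous_intros continuous_on_subset[OF continuous_on_product_coordinates]) auto
  then obtain a0 where a0: "a0 \<in> K"
    "\<And>a. a \<in> K \<Longrightarrow> norm (\<Sum>b\<in>B. a0 b *\<^sub>R b) \<le> norm (\<Sum>b\<in>B. a b *\<^sub>R b)"
    using continuous_attains_inf[OF K \<open>K \<noteq> {}\<close>] by blast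
  \<comment> \<open>The minimum over \<open>K\<close>; linear independence of \<open>B\<close> makes
    it positive, and \<open>1 / r\<close> is the required constant.\<close>
  define r where "r = norm (\<Sum>b\<in>B. a0 b *\<^sub>R b)"
  have "r > 0"
  proof -
    have "(\<Sum>b\<in>B. a0 b *\<^sub>R b) \<noteq> 0"
    proof
      assume "(\<Sum>b\<in>B. a0 b *\<^sub>R b) = 0"
      then have "\<forall>b\<in>B. a0 b = 0"
        using assms independentD[OF assms(2,1) subset_refl] by blast
      then show False using a0(1) by (simp add: K_def)
    qed
    then show ?thesis by (simp add: r_def)
  qed
  have "(\<Sum>b\<in>B. \<bar>a b\<bar>) \<le> (1 / r) * norm (\<Sum>b\<in>B. a b *\<^sub>R b)" for a
  proof (cases "(\<Sum>b\<in>B. \<bar>a b\<bar>) = 0")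
    case True
    then show ?thesis using \<open>r > 0\<close> by simp
  next
    case False
    \<comment> \<open>Both sides are homogeneous, so dividing by \<open>s\<close> reduces the claim
      to coefficients in \<open>K\<close>.\<close>
    define s where "s = (\<Sum>b\<in>B. \<bar>a b\<bar>)"
    have "s > 0" using False sum_nonneg[of B "\<lambda>b. \<bar>a b\<bar>"] by (simp add: s_def less_le)
    have "(\<Sum>b\<in>B. \<bar>a b / s\<bar>) = 1"
      using \<open>s > 0\<close> by (simp add: abs_divide flip: sum_divide_distrib s_def)
    then obtain a' where a': "a' \<in> K" "\<forall>b\<in>B. a' b = a b / s" using unit by meson
    have "r \<le> norm (\<Sum>b\<in>B. (a b / s) *\<^sub>R b)"
      using a0(2)[OF a'(1)] a'(2) by (simp add: r_def)
    also have "(\<Sum>b\<in>B. (a b / s) *\<^sub>R b) = (1 / s) *\<^sub>R (\<Sum>b\<in>B. a b *\<^sub>R b)"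
      by (simp add: scaleR_sum_right)
    finally show ?thesis
      using \<open>s > 0\<close> \<open>r > 0\<close> by (simp add: field_simps flip: s_def)
  qed
  then show ?thesis by blast
qed

text \<open>A single coordinate is at most the sum of the absolute values of all of them, which
  \<open>coordinate_bound\<close> controls by the norm. For \<open>b\<close> outside
  \<open>B\<close> the coordinate is 0.\<close>

lemma bounded_linear_representation_finite_span:
  fixes B :: "'a::real_normed_vector set"
  assumes "finite B" "independent B" "span B = UNIV"
  shows "bounded_linear (\<lambda>v. representation B v b)"
proof (cases "b \<in> B")
  case True
  obtain C where C: "\<And>a. (\<Sum>b\<in>B. \<bar>a b\<bar>) \<le> C * norm (\<Sum>b\<in>B. a b *\<^sub>R b)"
    using coordinate_bound[OF assms(1,2)] by blast
  show ?thesis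
  proof (rule bounded_linear_intro[where K = C])
    fix v
    have "norm (representation B v b) \<le> (\<Sum>b\<in>B. \<bar>representation B v b\<bar>)"
      using member_le_sum[OF True, of "\<lambda>b. \<bar>representation B v b\<bar>"] assms(1) by simp
    also have "\<dots> \<le> C * norm v"
      using C[of "representation B v"] sum_representation_eq[OF assms(2) _ assms(1) subset_refl, of v] assms(3) by simp
    finally show "norm (representation B v b) \<le> norm v * C" by (simp add: mult.commute)
  qed (use assms in \<open>simp_all add: representation_add representation_scale\<close>)
next
  case False
  then have "representation B v b = 0" for v
    using representation_ne_zero by blast
  then show ?thesis by simp
qed

section \<open>Calculus of \<open>Ck_on\<close>\<close>

lemma Ck_on_imp_continuous_on: "Ck_on k A f \<Longrightarrow> continuous_on A f"
proof (cases k)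
  case (Suc j)
  assume "Ck_on k A f"
  with Suc show ?thesis
    by (auto intro!: continuous_at_imp_continuous_on dest!: has_derivative_continuous)
qed simp

text \<open>The product and chain rules pair a derivative of order \<open>k\<close> with an
  undifferentiated factor of order \<open>Suc k\<close>; this lowers the latter to the order of the
  induction hypothesis.\<close>

lemma Ck_on_Suc_imp: "Ck_on (Suc k) A f \<Longrightarrow> Ck_on k A f"
proof (induction k arbitrary: f)
  case 0
  then show ?case using Ck_on_imp_continuous_on by (metis Ck_on.simps(1))
next
  case (Suc k)
  from Suc.prems obtain f' where
    f': "\<forall>x\<in>A. (f has_derivative blinfun_apply (f' x)) (at x)" "continuous_on A f'"
      "\<forall>v. Ck_on (Suc k) A (\<lambda>x. blinfun_apply (f' x) v)"
    by (subst (asm) Ck_on.simps(2)) blast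
  then show ?case
    using Suc.IH by (subst Ck_on.simps(2)) blast
qed

lemma Ck_on_subset: "Ck_on k A f \<Longrightarrow> B \<subseteq> A \<Longrightarrow> Ck_on k B f"
proof (induction k arbitrary: f)
  case 0
  then show ?case using continuous_on_subset by auto
next
  case (Suc k)
  then obtain f' where
    f': "\<forall>x\<in>A. (f has_derivative blinfun_apply (f' x)) (at x)" "continuous_on A f'"
      "\<forall>v. Ck_on k A (\<lambda>x. blinfun_apply (f' x) v)"
    by auto
  then show ?case
    using Suc.IH Suc.prems(2) continuous_on_subset by (subst Ck_on.simps(2)) blast
qed

text \<open>Derivatives are taken with respect to the full filter \<open>at x\<close>, so agreement
  of \<open>f\<close> and \<open>g\<close> on \<open>A\<close> transfers them because
  \<open>A\<close> is a neighbourhood of each of its points.\<close>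

lemma Ck_on_cong:
  assumes "Ck_on k A f" "open A" "\<And>x. x \<in> A \<Longrightarrow> f x = g x"
  shows "Ck_on k A g"
proof (cases k)
  case 0
  then show ?thesis using assms continuous_on_cong[of A A f g] by simp
next
  case (Suc j)
  with assms(1) obtain f' where
    f': "\<forall>x\<in>A. (f has_derivative blinfun_apply (f' x)) (at x)" "continuous_on A f'"
      "\<forall>v. Ck_on j A (\<lambda>x. blinfun_apply (f' x) v)"
    by auto
  moreover have "\<forall>x\<in>A. (g has_derivative blinfun_apply (f' x)) (at x)"
  proof
    fix x assume "x \<in> A"
    then show "(g has_derivative blinfun_apply (f' x)) (at x)"
      using has_derivative_transform_within_open[OF _ assms(2), of f _ x UNIV g] f'(1) assms(3)
      by blast
  qed
  ultimately show ?thesis using Suc by auto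
qed

text \<open>Local derivatives fit together because a Frechet derivative at a point is unique. This
  serves for maps into a manifold, where the chart changes from point to point.\<close>

lemma Ck_on_locally:
  assumes "\<And>x. x \<in> A \<Longrightarrow> \<exists>W. open W \<and> x \<in> W \<and> Ck_on k W f"
  shows "Ck_on k A f"
  using assms
proof (induction k arbitrary: f)
  case 0
  have "continuous (at x) f" if x: "x \<in> A" for x
  proof -
    obtain W where "open W" "x \<in> W" "Ck_on 0 W f" using 0 x by blast
    then show ?thesis by (simp add: continuous_on_eq_continuous_at)
  qed
  then show ?case by (simp add: continuous_at_imp_continuous_on)
next
  case (Suc k)
  \<comment> \<open>One choice of derivative at every point, independent of the neighbourhood;
    uniqueness identifies it with each local \<open>f'\<close>.\<close>
  define g where "g y = (SOME D. (f has_derivative blinfun_apply D) (at y))" for y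
  have g: "g y = D" if D: "(f has_derivative blinfun_apply D) (at y)" for y D
    unfolding g_def
  proof (rule some_equality)
    show "(f has_derivative blinfun_apply D) (at y)" by (fact D)
    show "D' = D" if "(f has_derivative blinfun_apply D') (at y)" for D'
      using has_derivative_unique[OF that D] by (simp add: blinfun_apply_inject)
  qed
  have local: "\<exists>W. open W \<and> x \<in> W \<and> (\<forall>y\<in>W. (f has_derivative blinfun_apply (g y)) (at y)) \<and>
      continuous_on W g \<and> (\<forall>v. Ck_on k W (\<lambda>y. blinfun_apply (g y) v))" if x: "x \<in> A" for x
  proof -
    obtain W where W: "open W" "x \<in> W" "Ck_on (Suc k) W f"
      using Suc.prems[OF x] by blast
    then obtain f' where f': "\<forall>y\<in>W. (f has_derivative blinfun_apply (f' y)) (at y)"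
        "continuous_on W f'" "\<forall>v. Ck_on k W (\<lambda>y. blinfun_apply (f' y) v)"
      by auto
    have eq: "f' y = g y" if "y \<in> W" for y
      using g f'(1) that by metis
    have "continuous_on W g"
      using f'(2) eq continuous_on_cong[of W W f' g] by simp
    moreover have "Ck_on k W (\<lambda>y. blinfun_apply (g y) v)" for v
      using Ck_on_cong[OF spec[OF f'(3)] W(1)] eq by simp
    ultimately show ?thesis using W(1,2) f'(1) eq by auto
  qed
  have "\<forall>x\<in>A. (f has_derivative blinfun_apply (g x)) (at x)"
    using local by blast
  moreover have "continuous_on A g"
  proof (intro continuous_at_imp_continuous_on ballI)
    fix x assume "x \<in> A"
    then obtain W where "open W" "x \<in> W" "continuous_on W g" using local by blast
    then show "continuous (at x) g" by (simp add: continuous_on_eq_continuous_at)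
  qed
  moreover have "Ck_on k A (\<lambda>y. blinfun_apply (g y) v)" for v
    using local by (intro Suc.IH) blast
  ultimately show ?case by auto
qed

lemma Ck_on_const: "Ck_on k A (\<lambda>x. c)"
proof (induction k arbitrary: c)
  case (Suc k)
  show ?case
    using Suc[of 0] by (auto simp: zero_blinfun.rep_eq intro!: exI[of _ "\<lambda>_. 0"])
qed simp

lemma Ck_on_add:
  "Ck_on k A f \<Longrightarrow> Ck_on k A g \<Longrightarrow> Ck_on k A (\<lambda>x. f x + g x)"
proof (induction k arbitrary: f g)
  case 0
  then show ?case by (simp add: continuous_on_add)
next
  case (Suc k)
  from Suc.prems obtain f' g' where
    f': "\<forall>x\<in>A. (f has_derivative blinfun_apply (f' x)) (at x)" "continuous_on A f'"
      "\<forall>v. Ck_on k A (\<lambda>x. blinfun_apply (f' x) v)" and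
    g': "\<forall>x\<in>A. (g has_derivative blinfun_apply (g' x)) (at x)" "continuous_on A g'"
      "\<forall>v. Ck_on k A (\<lambda>x. blinfun_apply (g' x) v)"
    by auto
  then show ?case
    by (auto simp: plus_blinfun.rep_eq
        intro!: exI[of _ "\<lambda>x. f' x + g' x"] continuous_on_add Suc.IH has_derivative_add)
qed

lemma Ck_on_sum:
  "(\<And>i. i \<in> I \<Longrightarrow> Ck_on k A (f i)) \<Longrightarrow> Ck_on k A (\<lambda>x. \<Sum>i\<in>I. f i x)"
  by (induction I rule: infinite_finite_induct) (auto simp: Ck_on_const Ck_on_add)

lemma Ck_on_bounded_linear:
  assumes "bounded_linear L"
  shows "Ck_on k A f \<Longrightarrow> Ck_on k A (\<lambda>x. L (f x))"
proof (induction k arbitrary: f)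
  case 0
  then show ?case using bounded_linear.continuous_on[OF assms] by auto
next
  case (Suc k)
  from Suc.prems obtain f' where
    f': "\<forall>x\<in>A. (f has_derivative blinfun_apply (f' x)) (at x)" "continuous_on A f'"
      "\<forall>v. Ck_on k A (\<lambda>x. blinfun_apply (f' x) v)"
    by auto
  have "\<forall>x\<in>A. ((\<lambda>x. L (f x)) has_derivative blinfun_apply (Blinfun L o\<^sub>L f' x)) (at x)"
    using f'(1)
    by (auto intro!: bounded_linear.has_derivative[OF assms] simp add: bounded_linear_Blinfun_apply[OF assms] blinfun_compose.rep_eq comp_def)
  moreover have "continuous_on A (\<lambda>x. Blinfun L o\<^sub>L f' x)"
    by (intro continuous_intros f')
  moreover have "Ck_on k A (\<lambda>x. blinfun_apply (Blinfun L o\<^sub>L f' x) v)" for v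
    using Suc.IH f'(3) by (simp add: bounded_linear_Blinfun_apply[OF assms])
  ultimately show ?case unfolding Ck_on.simps(2) by (intro exI[of _ "\<lambda>x. Blinfun L o\<^sub>L f' x"]) blast
qed

lemma Ck_on_scaleR:
  "Ck_on k A f \<Longrightarrow> Ck_on k A g \<Longrightarrow> Ck_on k A (\<lambda>x. f x *\<^sub>R g x)"
proof (induction k arbitrary: f g)
  case 0
  then show ?case by (simp add: continuous_on_scaleR)
next
  case (Suc k)
  from Suc.prems obtain f' g' where
    f': "\<forall>x\<in>A. (f has_derivative blinfun_apply (f' x)) (at x)" "continuous_on A f'"
      "\<And>v. Ck_on k A (\<lambda>x. blinfun_apply (f' x) v)" and
    g': "\<forall>x\<in>A. (g has_derivative blinfun_apply (g' x)) (at x)" "continuous_on A g'"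
      "\<And>v. Ck_on k A (\<lambda>x. blinfun_apply (g' x) v)"
    by auto
  \<comment> \<open>The Leibniz rule as a bounded operator: the second summand sends
    \<open>v\<close> to \<open>f' x v *\<^sub>R g x\<close>.\<close>
  let ?h = "\<lambda>x. f x *\<^sub>R g' x + (blinfun_scaleR_left (g x) o\<^sub>L f' x)"
  have "\<forall>x\<in>A. ((\<lambda>x. f x *\<^sub>R g x) has_derivative blinfun_apply (?h x)) (at x)"
    using f'(1) g'(1) by (auto simp: blinfun.bilinear_simps intro!: derivative_eq_intros)
  moreover have "continuous_on A ?h"
    by (intro continuous_intros f' g' Ck_on_imp_continuous_on[OF Suc.prems(1)]
        Ck_on_imp_continuous_on[OF Suc.prems(2)])
  moreover have "Ck_on k A (\<lambda>x. blinfun_apply (?h x) v)" for v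
    using Suc.IH[OF Ck_on_Suc_imp[OF Suc.prems(1)] g'(3)[of v]]
      Suc.IH[OF f'(3)[of v] Ck_on_Suc_imp[OF Suc.prems(2)]]
    by (simp add: blinfun.bilinear_simps Ck_on_add)
  ultimately show ?case unfolding Ck_on.simps(2) by (intro exI[of _ ?h]) blast
qed

text \<open>The directional derivative of \<open>g \<circ> f\<close> is a finite sum of products:
  coordinates of \<open>f' x v\<close>, and partial derivatives of \<open>g\<close> composed with
  \<open>f\<close>. The induction hypothesis applies to the latter with \<open>f\<close> fixed,
  hence \<open>g\<close> is generalized.\<close>

lemma Ck_on_compose:
  fixes f :: "'a::real_normed_vector \<Rightarrow> 'b::real_normed_vector"
    and g :: "'b \<Rightarrow> 'c::real_normed_vector"
  assumes B: "finite (B :: 'b set)" "span B = UNIV"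
    and "Ck_on k A f" "Ck_on k A' g" "f ` A \<subseteq> A'"
  shows "Ck_on k A (g \<circ> f)"
proof -
  obtain C where "C \<subseteq> B" "independent C" "span C = UNIV"
    using basis_exists[of B] B(2) span_mono span_span by (metis top.extremum_uniqueI)
  then have C: "finite C" "independent C" "span C = UNIV"
    using B(1) finite_subset by auto
  show ?thesis using assms(3-5)
  proof (induction k arbitrary: g)
    case 0
    then show ?case
      using continuous_on_compose[of A f g] continuous_on_subset[of A' g "f ` A"] by simp
  next
    case (Suc k)
    from Suc.prems(1,2) obtain f' g' where
      f': "\<forall>x\<in>A. (f has_derivative blinfun_apply (f' x)) (at x)" "continuous_on A f'"
        "\<And>v. Ck_on k A (\<lambda>x. blinfun_apply (f' x) v)" and
      g': "\<forall>y\<in>A'. (g has_derivative blinfun_apply (g' y)) (at y)" "continuous_on A' g'"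
        "\<And>v. Ck_on k A' (\<lambda>y. blinfun_apply (g' y) v)"
      by auto
    let ?h = "\<lambda>x. g' (f x) o\<^sub>L f' x"
    have "\<forall>x\<in>A. (g \<circ> f has_derivative blinfun_apply (?h x)) (at x)"
    proof
      fix x assume "x \<in> A"
      then show "(g \<circ> f has_derivative blinfun_apply (?h x)) (at x)"
        unfolding blinfun_compose.rep_eq
        using f'(1) g'(1) Suc.prems(3) by (intro diff_chain_at) auto
    qed
    moreover have "continuous_on A (\<lambda>x. g' (f x))"
      using continuous_on_compose2[OF g'(2) Ck_on_imp_continuous_on[OF Suc.prems(1)] Suc.prems(3)] .
    then have "continuous_on A ?h"
      by (intro continuous_intros f')
    moreover have "Ck_on k A (\<lambda>x. blinfun_apply (?h x) v)" for v
    proof -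
      \<comment> \<open>Expanding in the basis \<open>C\<close> separates the direction, which
        varies with \<open>x\<close>, from \<open>g'\<close>, which is then evaluated only in fixed
        directions \<open>b\<close>, as \<open>Ck_on\<close> requires.\<close>
      have "blinfun_apply (?h x) v =
          (\<Sum>b\<in>C. representation C (blinfun_apply (f' x) v) b *\<^sub>R (((\<lambda>y. blinfun_apply (g' y) b) \<circ> f) x))" for x
      proof -
        have "blinfun_apply (?h x) v = blinfun_apply (g' (f x))
            (\<Sum>b\<in>C. representation C (blinfun_apply (f' x) v) b *\<^sub>R b)"
          using sum_representation_eq[OF C(2) _ C(1) subset_refl] C(3) by simp
        then show ?thesis by (simp add: blinfun.sum_right blinfun.scaleR_right)
      qed
      moreover have "Ck_on k A (\<lambda>x. \<Sum>b\<in>C. representation C (blinfun_apply (f' x) v) b *\<^sub>R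
          ((\<lambda>y. blinfun_apply (g' y) b) \<circ> f) x)"
      proof (intro Ck_on_sum Ck_on_scaleR)
        fix b
        show "Ck_on k A (\<lambda>x. representation C (blinfun_apply (f' x) v) b)"
          by (rule Ck_on_bounded_linear[OF bounded_linear_representation_finite_span[OF C] f'(3)])
        show "Ck_on k A ((\<lambda>y. blinfun_apply (g' y) b) \<circ> f)"
          by (rule Suc.IH[OF Ck_on_Suc_imp[OF Suc.prems(1)] g'(3) Suc.prems(3)])
      qed
      ultimately show ?thesis by simp
    qed
    ultimately show ?case unfolding Ck_on.simps(2) by (intro exI[of _ ?h] conjI allI)
  qed
qed

section \<open>Composition with maps into manifolds\<close>

lemma open_vec_preimage:
  assumes "open W" "continuous_map (top_of_set W) X f" "openin X D"
  shows "open {y \<in> W. f y \<in> D}"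
  using openin_continuous_map_preimage[OF assms(2,3)] openin_open_trans[OF _ assms(1)] by simp

lemma open_inj_chart:
  assumes "smooth_manifold M" "c \<in> atlas M"
  shows "openin (mtop M) (fst c)" "inj_on (snd c) (fst c)"
  using assms by (auto simp: smooth_manifold_def homeomorphic_map_def openin_subset
      topspace_subtopology inf.absorb2 dest!: bspec)

text \<open>Near each point the coordinate expression of \<open>g \<circ> f\<close> factors through
  a chart of \<open>M\<close> around the image point, where the chain rule applies; the local
  results are then glued.\<close>

lemma smooth_map_vec_compose:
  assumes W: "open W" and M: "smooth_manifold M" and N: "smooth_manifold N"
    and f: "smooth_map (vec_mfd W) M f" and g: "smooth_map M N g"
  shows "smooth_map (vec_mfd W) N (g \<circ> f)"
proof -
  have cf: "continuous_map (top_of_set W) (mtop M) f" and cg: "continuous_map (mtop M) (mtop N) g"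
    using f g by (auto simp: smooth_map_def vec_mfd_def)
  then have cgf: "continuous_map (top_of_set W) (mtop N) (g \<circ> f)"
    by (rule continuous_map_compose)
  obtain B :: "'c set" where B: "finite B" "span B = UNIV"
    using M by (auto simp: smooth_manifold_def)
  have "smooth_on {y \<in> W. g (f y) \<in> E} (\<psi> \<circ> (g \<circ> f) \<circ> inv_into W (\<lambda>x. x))"
    if psi: "(E, \<psi>) \<in> atlas N" for E \<psi>
    unfolding smooth_on_def
  proof (intro conjI allI)
    have "openin (mtop N) E" using N psi by (auto simp: smooth_manifold_def)
    then show A: "open {y \<in> W. g (f y) \<in> E}"
      using open_vec_preimage[OF W cgf] by simp
    fix k
    show "Ck_on k {y \<in> W. g (f y) \<in> E} (\<psi> \<circ> (g \<circ> f) \<circ> inv_into W (\<lambda>x. x))"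
    proof (rule Ck_on_locally)
      fix x assume x: "x \<in> {y \<in> W. g (f y) \<in> E}"
      then have "f x \<in> topspace (mtop M)"
        using cf by (auto simp: continuous_map_def)
      then obtain D \<phi> where c: "(D, \<phi>) \<in> atlas M" "f x \<in> D"
        using M by (auto simp: smooth_manifold_def)
      have D: "openin (mtop M) D" and inj: "inj_on \<phi> D"
        using open_inj_chart[OF M c(1)] by simp_all
      \<comment> \<open>On \<open>W'\<close> the map \<open>f\<close> stays in the single chart
        domain \<open>D\<close>, so \<open>inv_into D \<phi>\<close> cancels \<open>\<phi>\<close>,
        and \<open>g \<circ> f\<close> stays in \<open>E\<close>.\<close>
      define W' where "W' = {y \<in> W. f y \<in> D} \<inter> {y \<in> W. g (f y) \<in> E}"
      have "open W'" "x \<in> W'"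
        using open_vec_preimage[OF W cf D] A x c(2) by (auto simp: W'_def)
      have "Ck_on k {y \<in> W. f y \<in> D} (\<phi> \<circ> f \<circ> inv_into W (\<lambda>x. x))"
        using f c(1) by (force simp: smooth_map_def vec_mfd_def smooth_on_def)
      then have 1: "Ck_on k W' (\<phi> \<circ> f \<circ> inv_into W (\<lambda>x. x))"
        by (rule Ck_on_subset) (auto simp: W'_def)
      \<comment> \<open>The inverse of the identity chart of \<open>vec_mfd W\<close>; it is known
        to be the identity only on \<open>W\<close>.\<close>
      have id: "inv_into W (\<lambda>x. x) y = y" if "y \<in> W" for y
        using inv_into_f_f[of "\<lambda>x. x" W y] that by simp
      have 2: "Ck_on k (\<phi> ` {y \<in> D. g y \<in> E}) (\<psi> \<circ> g \<circ> inv_into D \<phi>)"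
        using g c(1) psi by (force simp: smooth_map_def smooth_on_def)
      have "Ck_on k W' ((\<psi> \<circ> g \<circ> inv_into D \<phi>) \<circ> (\<phi> \<circ> f \<circ> inv_into W (\<lambda>x. x)))"
        by (rule Ck_on_compose[OF B 1 2]) (auto simp: W'_def id)
      then have "Ck_on k W' (\<psi> \<circ> (g \<circ> f) \<circ> inv_into W (\<lambda>x. x))"
        by (rule Ck_on_cong[OF _ \<open>open W'\<close>]) (auto simp: W'_def id inv_into_f_f[OF inj])
      then show "\<exists>W'. open W' \<and> x \<in> W' \<and> Ck_on k W' (\<psi> \<circ> (g \<circ> f) \<circ> inv_into W (\<lambda>x. x))"
        using \<open>open W'\<close> \<open>x \<in> W'\<close> by blast
    qed
  qed
  then show ?thesis
    using cgf by (auto simp: smooth_map_def vec_mfd_def)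
qed

text \<open>\<open>frechet_derivative\<close> is a choice that is meaningful only for a
  differentiable map. Differentiability comes from order 1 of smoothness, and
  \<open>\<sigma>\<close> fixing the identity places the base point in the domain of the coordinate
  expression.\<close>

lemma has_derivative_differential_at_one:
  assumes M: "smooth_manifold M" and c: "c \<in> atlas M" "\<one>\<^bsub>G\<^esub> \<in> fst c"
    and \<sigma>: "smooth_map M M \<sigma>" "\<sigma> \<one>\<^bsub>G\<^esub> = \<one>\<^bsub>G\<^esub>"
  shows "(snd c \<circ> \<sigma> \<circ> inv_into (fst c) (snd c) has_derivative differential_at_one G c \<sigma>)
    (at (snd c \<one>\<^bsub>G\<^esub>))"
proof -
  obtain D \<phi> where cD: "c = (D, \<phi>)" by (cases c)
  have "Ck_on (Suc 0) (\<phi> ` {y \<in> D. \<sigma> y \<in> D}) (\<phi> \<circ> \<sigma> \<circ> inv_into D \<phi>)"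
    using \<sigma>(1) c(1) unfolding cD smooth_map_def smooth_on_def by fast
  moreover have "\<phi> \<one>\<^bsub>G\<^esub> \<in> \<phi> ` {y \<in> D. \<sigma> y \<in> D}"
    using c(2) \<sigma>(2) by (auto simp: cD)
  ultimately have "(\<phi> \<circ> \<sigma> \<circ> inv_into D \<phi>) differentiable (at (\<phi> \<one>\<^bsub>G\<^esub>))"
    unfolding Ck_on.simps(2) differentiable_def by blast
  then show ?thesis
    by (simp add: cD differential_at_one_def frechet_derivative_works)
qed

lemma has_vector_derivative_comp_chart:
  assumes M: "smooth_manifold M" and c: "c \<in> atlas M" "\<one>\<^bsub>G\<^esub> \<in> fst c"
    and \<sigma>: "smooth_map M M \<sigma>" "\<sigma> \<one>\<^bsub>G\<^esub> = \<one>\<^bsub>G\<^esub>"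
    and \<gamma>: "smooth_map (vec_mfd UNIV) M \<gamma>" "\<gamma> 0 = \<one>\<^bsub>G\<^esub>"
    and Z: "((\<lambda>t. snd c (\<gamma> t)) has_vector_derivative Z) (at 0)"
  shows "((\<lambda>t. snd c (\<sigma> (\<gamma> t))) has_vector_derivative differential_at_one G c \<sigma> Z) (at 0)"
proof -
  have "((snd c \<circ> \<sigma> \<circ> inv_into (fst c) (snd c)) \<circ> (\<lambda>t. snd c (\<gamma> t))
      has_vector_derivative differential_at_one G c \<sigma> Z) (at 0)"
  proof (rule vector_derivative_diff_chain_within[OF Z])
    show "(snd c \<circ> \<sigma> \<circ> inv_into (fst c) (snd c) has_derivative differential_at_one G c \<sigma>)
        (at (snd c (\<gamma> 0)) within range (\<lambda>t. snd c (\<gamma> t)))"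
      using has_derivative_at_withinI[OF has_derivative_differential_at_one[OF M c \<sigma>]] \<gamma>(2) by simp
  qed
  \<comment> \<open>The chain rule concerns a map with \<open>inv_into (fst c) (snd c)\<close>
    inserted after \<open>snd c\<close>; the two cancel while \<open>\<gamma> t\<close> lies in the
    chart domain, an open condition satisfied at 0.\<close>
  moreover have "open {t \<in> UNIV. \<gamma> t \<in> fst c}"
    using \<gamma>(1) open_inj_chart(1)[OF M c(1)]
    by (intro open_vec_preimage) (auto simp: smooth_map_def vec_mfd_def)
  ultimately show ?thesis
    by (rule has_vector_derivative_transform_within_open)
      (use \<gamma>(2) c(2) inv_into_f_f[OF open_inj_chart(2)[OF M c(1)]] in auto)
qed

section \<open>One-parameter subgroups and the exponential map\<close>

text \<open>Continuity of \<open>\<gamma>\<close> puts its values in the topological space of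
  \<open>M\<close>, which is the carrier of the group.\<close>

lemma one_parameter_subgroup_in_carrier:
  assumes "lie_group G M" "one_parameter_subgroup G M c Z \<gamma>"
  shows "\<gamma> t \<in> carrier G"
  using assms
  by (auto simp: lie_group_def one_parameter_subgroup_def smooth_map_def vec_mfd_def continuous_map_def)

lemma one_parameter_subgroup_hom:
  assumes G: "lie_group G M" and c: "c \<in> atlas M" "\<one>\<^bsub>G\<^esub> \<in> fst c"
    and \<sigma>: "\<sigma> \<in> hom G G" "smooth_map M M \<sigma>"
    and \<gamma>: "one_parameter_subgroup G M c Z \<gamma>"
  shows "one_parameter_subgroup G M c (differential_at_one G c \<sigma> Z) (\<sigma> \<circ> \<gamma>)"
proof -
  interpret group G using G by (simp add: lie_group_def)
  have M: "smooth_manifold M" and top: "topspace (mtop M) = carrier G"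
    using G by (auto simp: lie_group_def)
  have smooth: "smooth_map (vec_mfd UNIV) M \<gamma>" and mult: "\<And>s t. \<gamma> (s + t) = \<gamma> s \<otimes>\<^bsub>G\<^esub> \<gamma> t"
    and Z: "((\<lambda>t. snd c (\<gamma> t)) has_vector_derivative Z) (at 0)"
    using \<gamma> by (auto simp: one_parameter_subgroup_def)
  have carr: "\<gamma> t \<in> carrier G" for t
    using one_parameter_subgroup_in_carrier[OF G \<gamma>] .
  \<comment> \<open>Cancellation in
    \<open>\<gamma> 0 = \<gamma> 0 \<otimes> \<gamma> 0\<close>.\<close>
  have "\<gamma> 0 = \<one>\<^bsub>G\<^esub>"
    using mult[of 0 0] carr[of 0] by (simp add: l_cancel_one)
  moreover have "\<sigma> \<one>\<^bsub>G\<^esub> = \<one>\<^bsub>G\<^esub>"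
    using hom_one[OF \<sigma>(1)] is_group by simp
  ultimately have "((\<lambda>t. snd c (\<sigma> (\<gamma> t))) has_vector_derivative differential_at_one G c \<sigma> Z) (at 0)"
    using has_vector_derivative_comp_chart[OF M c \<sigma>(2) _ smooth _ Z] by simp
  moreover have "\<sigma> (\<gamma> (s + t)) = \<sigma> (\<gamma> s) \<otimes>\<^bsub>G\<^esub> \<sigma> (\<gamma> t)" for s t
    using mult hom_mult[OF \<sigma>(1) carr carr] by simp
  ultimately show ?thesis
    using smooth_map_vec_compose[OF open_UNIV M M smooth \<sigma>(2)]
    by (simp add: one_parameter_subgroup_def)
qed

text \<open>The differential is linear, being a Frechet derivative at the identity, which
  \<open>\<sigma>\<close> fixes.\<close>

lemma minus_eigenspace_uminus:
  assumes G: "lie_group G M" and c: "c \<in> atlas M" "\<one>\<^bsub>G\<^esub> \<in> fst c"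
    and \<sigma>: "\<sigma> \<in> hom G G" "smooth_map M M \<sigma>" and P: "P \<in> minus_eigenspace G c \<sigma>"
  shows "- P \<in> minus_eigenspace G c \<sigma>"
proof -
  interpret group G using G by (simp add: lie_group_def)
  have "linear (differential_at_one G c \<sigma>)"
    using has_derivative_differential_at_one[OF _ c \<sigma>(2)] G hom_one[OF \<sigma>(1)] is_group
      has_derivative_linear by (auto simp: lie_group_def)
  from linear_neg[OF this, of P] P show ?thesis by (simp add: minus_eigenspace_def)
qed

lemma lie_exp_in_carrier:
  assumes G: "lie_group G M"
  shows "lie_exp G M c Z \<in> carrier G"
proof (cases "\<exists>!\<gamma>. one_parameter_subgroup G M c Z \<gamma>")
  case True
  then show ?thesis
    using one_parameter_subgroup_in_carrier[OF G theI'[OF True]] by (simp add: lie_exp_def)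
next
  case False
  interpret group G using G by (simp add: lie_group_def)
  show ?thesis using False by (simp add: lie_exp_def)
qed

text \<open>Composition with \<open>\<sigma>\<close> exchanges the one-parameter subgroups of \<open>P\<close> and of \<open>- P\<close>, so the
  junk branch of \<open>lie_exp\<close> is taken at both or at neither, and existence and uniqueness of
  one-parameter subgroups are not needed.\<close>

lemma lie_exp_uminus:
  assumes G: "lie_group G M" and c: "c \<in> atlas M" "\<one>\<^bsub>G\<^esub> \<in> fst c"
    and \<sigma>: "involutive_automorphism G \<sigma>" "smooth_map M M \<sigma>"
    and P: "P \<in> minus_eigenspace G c \<sigma>"
  shows "lie_exp G M c (- P) = \<sigma> (lie_exp G M c P)"
proof -
  interpret group G using G by (simp add: lie_group_def)
  let ?ops = "one_parameter_subgroup G M c"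
  have hom: "\<sigma> \<in> hom G G" and inv: "\<And>g. g \<in> carrier G \<Longrightarrow> \<sigma> (\<sigma> g) = g"
    using \<sigma>(1) by (auto simp: involutive_automorphism_def iso_def)
  have swap: "?ops (- Q) (\<sigma> \<circ> \<gamma>)" if "Q \<in> minus_eigenspace G c \<sigma>" "?ops Q \<gamma>" for Q \<gamma>
    using one_parameter_subgroup_hom[OF G c hom \<sigma>(2) that(2)] that(1)
    by (simp add: minus_eigenspace_def)
  have invol: "\<sigma> \<circ> (\<sigma> \<circ> \<gamma>) = \<gamma>" if "?ops Q \<gamma>" for Q \<gamma>
    using inv one_parameter_subgroup_in_carrier[OF G that] by auto
  \<comment> \<open>A competitor \<open>\<gamma>'\<close> for \<open>- Q\<close> is carried by
    \<open>\<sigma>\<close> to a subgroup for \<open>Q\<close>, hence to \<open>\<gamma>\<close>;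
    applying \<open>\<sigma>\<close> once more recovers \<open>\<gamma>'\<close>.\<close>
  have ex1: "?ops (- Q) (\<sigma> \<circ> \<gamma>) \<and> (\<forall>\<gamma>'. ?ops (- Q) \<gamma>' \<longrightarrow> \<gamma>' = \<sigma> \<circ> \<gamma>)"
    if Q: "Q \<in> minus_eigenspace G c \<sigma>" and \<gamma>: "?ops Q \<gamma>" and u: "\<And>\<gamma>'. ?ops Q \<gamma>' \<Longrightarrow> \<gamma>' = \<gamma>" for Q \<gamma>
  proof (intro conjI allI impI)
    show "?ops (- Q) (\<sigma> \<circ> \<gamma>)" using swap[OF Q \<gamma>] .
    fix \<gamma>' assume \<gamma>': "?ops (- Q) \<gamma>'"
    have "?ops Q (\<sigma> \<circ> \<gamma>')"
      using swap[OF minus_eigenspace_uminus[OF G c hom \<sigma>(2) Q] \<gamma>'] by simp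
    then have "\<sigma> \<circ> \<gamma>' = \<gamma>" by (rule u)
    then show "\<gamma>' = \<sigma> \<circ> \<gamma>" using invol[OF \<gamma>'] by simp
  qed
  show ?thesis
  proof (cases "\<exists>!\<gamma>. ?ops P \<gamma>")
    case True
    then obtain \<gamma> where \<gamma>: "?ops P \<gamma>" "\<And>\<gamma>'. ?ops P \<gamma>' \<Longrightarrow> \<gamma>' = \<gamma>" by blast
    note ex = ex1[OF P this]
    have "(THE \<gamma>. ?ops P \<gamma>) = \<gamma>" "(THE \<gamma>. ?ops (- P) \<gamma>) = \<sigma> \<circ> \<gamma>"
      using \<gamma> ex by (blast intro!: the_equality)+
    moreover have "\<exists>!\<gamma>. ?ops (- P) \<gamma>" using ex by blast
    ultimately show ?thesis using True by (simp add: lie_exp_def)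
  next
    case False
    have "\<not> (\<exists>!\<gamma>. ?ops (- P) \<gamma>)"
    proof
      assume "\<exists>!\<gamma>. ?ops (- P) \<gamma>"
      then obtain \<gamma> where "?ops (- P) \<gamma>" "\<And>\<gamma>'. ?ops (- P) \<gamma>' \<Longrightarrow> \<gamma>' = \<gamma>" by blast
      \<comment> \<open>The same transfer started at \<open>- P\<close> returns to
        \<open>- (- P) = P\<close>.\<close>
      from ex1[OF minus_eigenspace_uminus[OF G c hom \<sigma>(2) P] this] have "\<exists>!\<gamma>. ?ops P \<gamma>"
        unfolding minus_minus by blast
      with False show False ..
    qed
    \<comment> \<open>Both exponentials take the default value, the identity, which
      \<open>\<sigma>\<close> fixes.\<close>
    with False show ?thesis using hom_one[OF hom] is_group by (simp add: lie_exp_def)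
  qed
qed

section \<open>The symmetry and the interpolant\<close>

text \<open>Well-definedness of the symmetry: two group elements carrying \<open>\<eta>\<close> to
  the same point differ by a right factor \<open>k\<close> in the stabilizer. As
  \<open>\<sigma>\<close> fixes \<open>k\<close>, the factor survives in \<open>\<sigma> g\<close>
  and disappears when applied to \<open>\<eta>\<close>.\<close>

lemma symmetry_at_act:
  assumes act: "group_action G S act" and \<eta>: "\<eta> \<in> S" "stabilizer G act \<eta> = fixed_subgroup G \<sigma>"
    and \<sigma>: "\<sigma> \<in> hom G G" and g: "g \<in> carrier G"
  shows "symmetry_at G act \<sigma> \<eta> (act g \<eta>) = act (\<sigma> g) \<eta>"
  unfolding symmetry_at_def
proof (rule the_equality)
  interpret group_action G S act by (fact act)
  interpret group G using group_hom by (simp add: group_hom_def)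
  show "\<exists>h\<in>carrier G. act g \<eta> = act h \<eta> \<and> act (\<sigma> g) \<eta> = act (\<sigma> h) \<eta>"
    using g by blast
  fix v assume "\<exists>h\<in>carrier G. act g \<eta> = act h \<eta> \<and> v = act (\<sigma> h) \<eta>"
  then obtain h where h: "h \<in> carrier G" "act g \<eta> = act h \<eta>" "v = act (\<sigma> h) \<eta>" by blast
  define k where "k = inv\<^bsub>G\<^esub> h \<otimes>\<^bsub>G\<^esub> g"
  have k: "k \<in> carrier G" "g = h \<otimes>\<^bsub>G\<^esub> k"
    using g h(1) by (simp_all add: k_def flip: m_assoc)
  have "act k \<eta> = \<eta>"
    using composition_rule[OF \<eta>(1) inv_closed[OF h(1)] g] orbit_sym_aux[OF h(1) \<eta>(1)] h(2)
    by (simp add: k_def)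
  then have "\<sigma> k = k"
    using \<eta>(2) k(1) by (auto simp: stabilizer_def fixed_subgroup_def)
  then have "\<sigma> g = \<sigma> h \<otimes>\<^bsub>G\<^esub> k"
    using hom_mult[OF \<sigma> h(1) k(1)] k(2) by simp
  then show "v = act (\<sigma> g) \<eta>"
    using composition_rule[OF \<eta>(1) hom_in_carrier[OF \<sigma> h(1)] k(1)] \<open>act k \<eta> = \<eta>\<close> h(3) by simp
qed

theorem proposition3p2:
  fixes G :: "('g, 'x) monoid_scheme"
    and MG :: "('g, 'e::real_normed_vector) mfd"
    and c :: "('g, 'e) chart"
    and \<sigma> :: "'g \<Rightarrow> 'g"
    and MS :: "('s, 'f::real_normed_vector) mfd"
    and act :: "'g \<Rightarrow> 's \<Rightarrow> 's"
    and \<eta> :: 's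
    and \<pp> U :: "'e set" and V :: "'s set"
    and F :: "'e \<Rightarrow> 's"
    and s\<^sub>\<eta> :: "'s \<Rightarrow> 's"
    and \<Omega> :: "(real ^ 'd::finite) set"
    and m :: nat and pt :: "nat \<Rightarrow> real ^ 'd"
    and u :: "real ^ 'd \<Rightarrow> 's"
    and Ihat :: "(real ^ 'd \<Rightarrow> 'e) \<Rightarrow> real ^ 'd \<Rightarrow> 'e"
  assumes lie: "lie_group G MG"
    and chart_at_one: "c \<in> atlas MG" "\<one>\<^bsub>G\<^esub> \<in> fst c"
    and sigma: "involutive_automorphism G \<sigma>" "smooth_map MG MG \<sigma>"
    and S: "smooth_manifold MS"
    and action: "transitive_action G (topspace (mtop MS)) act"
      "smooth_map (prod_mfd MG MS) MS (\<lambda>(g, v). act g v)"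
    and eta: "\<eta> \<in> topspace (mtop MS)" "stabilizer G act \<eta> = fixed_subgroup G \<sigma>"
    and p_def: "\<pp> = minus_eigenspace G c \<sigma>"
    and s_def: "s\<^sub>\<eta> = symmetry_at G act \<sigma> \<eta>"
    and F_def: "F = exp_orbit_map G MG c act \<eta>"
    and U: "openin (top_of_set \<pp>) U" "0 \<in> U" "uminus ` U = U"
    and V: "openin (mtop MS) V" "\<eta> \<in> V"
    and F_diffeo: "diffeo_onto U MS V F"
    and Omega: "open \<Omega>" "connected \<Omega>" "\<Omega> \<noteq> {}"
    and pts: "\<forall>i\<in>{1..m}. pt i \<in> \<Omega>"
    and u_smooth: "smooth_map (vec_mfd \<Omega>) MS u"
    and u_range: "\<forall>x\<in>\<Omega>. u x \<in> V"
    and Ihat: "interpolation_operator \<Omega> \<pp> m pt Ihat"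
    and Ihat_commutes: "\<forall>P \<in> \<Omega> \<rightarrow>\<^sub>E \<pp>. \<forall>x\<in>\<Omega>. Ihat (\<lambda>y\<in>\<Omega>. - P y) x = - Ihat P x"
  shows "\<forall>x\<in>\<Omega>. interpolant F U Ihat \<Omega> (\<lambda>y. s\<^sub>\<eta> (u y)) x = s\<^sub>\<eta> (interpolant F U Ihat \<Omega> u x)"
proof
  fix x assume x: "x \<in> \<Omega>"
  have hom: "\<sigma> \<in> hom G G"
    using sigma(1) by (simp add: involutive_automorphism_def iso_def)
  have act: "group_action G (topspace (mtop MS)) act"
    using action(1) by (simp add: transitive_action_def)
  \<comment> \<open>Stated on all of \<open>\<pp>\<close> and not just on \<open>U\<close>, because
    it is also applied to \<open>Ihat P x\<close>, which is only known to lie in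
    \<open>\<pp>\<close>.\<close>
  have sF: "s\<^sub>\<eta> (F P) = F (- P)" if "P \<in> \<pp>" for P
    using symmetry_at_act[OF act eta hom lie_exp_in_carrier[OF lie]]
      lie_exp_uminus[OF lie chart_at_one sigma] that
    by (simp add: s_def F_def p_def exp_orbit_map_def)
  have bij: "bij_betw F U V" using F_diffeo by (simp add: diffeo_onto_def)
  have "U \<subseteq> \<pp>" using U(1) openin_imp_subset by blast
  define P where "P = (\<lambda>y\<in>\<Omega>. inv_into U F (u y))"
  have P: "P y \<in> U" "F (P y) = u y" if "y \<in> \<Omega>" for y
    using u_range that bij_betw_apply[OF bij_betw_inv_into[OF bij]]
      bij_betw_inv_into_right[OF bij] by (auto simp: P_def)
  have "(\<lambda>y\<in>\<Omega>. inv_into U F (s\<^sub>\<eta> (u y))) = (\<lambda>y\<in>\<Omega>. - P y)"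
  proof (rule restrict_ext)
    fix y assume y: "y \<in> \<Omega>"
    have "s\<^sub>\<eta> (u y) = F (- P y)"
      using sF[of "P y"] P[OF y] \<open>U \<subseteq> \<pp>\<close> by auto
    \<comment> \<open>Symmetry of \<open>U\<close> enters here: \<open>inv_into U F\<close> returns
      \<open>- P y\<close> only if this point lies in \<open>U\<close>.\<close>
    moreover have "- P y \<in> U" using P(1)[OF y] U(3) by blast
    ultimately show "inv_into U F (s\<^sub>\<eta> (u y)) = - P y"
      using bij_betw_inv_into_left[OF bij] by simp
  qed
  moreover have P_in: "P \<in> \<Omega> \<rightarrow>\<^sub>E \<pp>"
    using P(1) \<open>U \<subseteq> \<pp>\<close> by (auto simp: P_def)
  moreover have "Ihat P x \<in> \<pp>"
    using Ihat P_in x by (auto simp: interpolation_operator_def)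
  \<comment> \<open>With the new interpolation data equal to \<open>- P\<close>, the sign passes
    first through \<open>Ihat\<close> and then, by \<open>sF\<close> at \<open>Ihat P x\<close>,
    through \<open>F\<close>.\<close>
  ultimately show "interpolant F U Ihat \<Omega> (\<lambda>y. s\<^sub>\<eta> (u y)) x = s\<^sub>\<eta> (interpolant F U Ihat \<Omega> u x)"
    using Ihat_commutes x sF by (simp add: interpolant_def flip: P_def)
qed

end
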